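(* Suppose that $\varrho$ is an irreducible substitution on a compact Hausdorff alphabet $\mathcal{A}$, that it admits a natural length function $\ell$, and that its subshift $X$ is uniquely ergodic. Let $r$ be the spectral radius of the substitution operator of $\varrho$. Then, following a suitable rescaling of $\ell$ (i.e. after replacing $\ell$ by $c\ell$ for some constant $c>0$), for all $\epsilon>0$ there exists some $N=N(\epsilon)\in\mathbb{N}$ such that, for all $n\ge N$ and all $a\in\mathcal{A}$, $$\left|\frac{r^n\ell(a)}{\#\varrho^n(a)}-1\right|\le\epsilon .$$
   Context: Alphabet and words: $\mathcal{A}$ is a non-empty compact Hausdorff space; $\mathcal{A}^\ast = \bigsqcup_{i\ge 0}\mathcal{A}^i$ is the space of finite words (product topologies, disjoint union topology). $\#u$ is the length of a word $u$; $v\triangleleft u$ means that $v$ is a (contiguous) subword of the finite or bi-infinite word $u$. Substitutions: a substitution is a continuous map $\varrho\colon\mathcal{A}\to\mathcal{A}^\ast$, extended to $\mathcal{A}^\ast$ by concatenation. Standing assumption: $\varrho$ generates arbitrarily long words, i.e. for every $k\in\mathbb{N}$ there are $n\in\mathbb{N}$ and $a\in\mathcal{A}$ with $\#\varrho^n(a)\ge k$. $\varrho$ is irreducible if there is no non-empty closed proper subset $\mathcal{B}\subsetneq\mathcal{A}$ with $\varrho(\mathcal{B})\subset\mathcal{B}^\ast$. The substitution operator $M$ on $C(\mathcal{A})$ (real continuous functions, sup norm) is $(Mf)(a)=\sum_{b\triangleleft\varrho(a)}f(b)$ (sum over letters of $\varrho(a)$ with multiplicity). A natural length function is a non-zero,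 non-negative $\ell\in C(\mathcal{A})$ with $M\ell=\lambda\ell$ for some $\lambda\ge0$. Subshift: $\mathcal{L}(\varrho)$ is the closure in $\mathcal{A}^\ast$ of the set of words $u$ with $u\triangleleft\varrho^n(a)$ for some $n\in\mathbb{N}_0$, $a\in\mathcal{A}$. $X=\{w\in\mathcal{A}^{\mathbb{Z}} : \text{every finite } u\triangleleft w \text{ lies in } \mathcal{L}(\varrho)\}$ (subspace of the product topology), with left shift $\sigma$. A measure on $X$ is a positive continuous linear functional $\mu$ on $C(X)$; it is a probability measure if $\mu(\mathbf{1})=1$ and $\sigma$-invariant if $\mu(f\circ\sigma)=\mu(f)$ for all $f\in C(X)$. $X$ is uniquely ergodic if it has exactly one $\sigma$-invariant probability measure. *)

theory Defs
  imports "HOL-Analysis.Analysis" "HOL-Library.Sublist"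
begin

section \<open>Words and substitutions\<close>

text \<open>
  The alphabet is the whole type \<open>'a\<close>. A word of length \<open>n\<close> is identified with the pair
  of \<open>n\<close> and a point of the product of \<open>n\<close> copies of the alphabet; the topology on lists is the
  one that makes this a homeomorphism onto the disjoint union of these products.
\<close>

definition word_point :: "'a list \<Rightarrow> nat \<times> (nat \<Rightarrow> 'a)" where
  "word_point u = (length u, restrict ((!) u) {..<length u})"

definition word_topology :: "'a::topological_space list topology" where
  "word_topology = pullback_topology UNIV word_point
     (sum_topology (\<lambda>n. product_topology (\<lambda>_. euclidean) {..<n}) UNIV)"

definition subst_word :: "('a \<Rightarrow> 'a list) \<Rightarrow> 'a list \<Rightarrow> 'a list" where
  "subst_word \<rho> u = concat (map \<rho> u)"

definition subst_iter :: "('a \<Rightarrow> 'a list) \<Rightarrow> nat \<Rightarrow> 'a \<Rightarrow> 'a list" where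
  "subst_iter \<rho> n a = (subst_word \<rho> ^^ n) [a]"

definition substitution :: "('a::topological_space \<Rightarrow> 'a list) \<Rightarrow> bool" where
  "substitution \<rho> \<longleftrightarrow> continuous_map euclidean word_topology \<rho> \<and>
     (\<forall>k. \<exists>n a. length (subst_iter \<rho> n a) \<ge> k)"

definition irreducible_subst :: "('a::topological_space \<Rightarrow> 'a list) \<Rightarrow> bool" where
  "irreducible_subst \<rho> \<longleftrightarrow>
     \<not> (\<exists>B. closed B \<and> B \<noteq> {} \<and> B \<noteq> UNIV \<and> \<rho> ` B \<subseteq> lists B)"


section \<open>The substitution operator\<close>

text \<open>
  For a compact alphabet, \<open>'a \<Rightarrow>\<^sub>C real\<close> is the space of all continuous functions with the
  sup norm. Lemma \<open>subst_op_apply\<close> below shows that the two coercions in the definition are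
  harmless for a substitution.
\<close>

definition subst_op ::
    "('a::topological_space \<Rightarrow> 'a list) \<Rightarrow> ('a \<Rightarrow>\<^sub>C real) \<Rightarrow>\<^sub>L ('a \<Rightarrow>\<^sub>C real)" where
  "subst_op \<rho> = Blinfun (\<lambda>f. Bcontfun (\<lambda>a. \<Sum>b\<leftarrow>\<rho> a. apply_bcontfun f b))"

definition natural_length ::
    "('a::topological_space \<Rightarrow> 'a list) \<Rightarrow> ('a \<Rightarrow>\<^sub>C real) \<Rightarrow> bool" where
  "natural_length \<rho> l \<longleftrightarrow> l \<noteq> 0 \<and> (\<forall>a. 0 \<le> apply_bcontfun l a) \<and>
     (\<exists>c\<ge>0. blinfun_apply (subst_op \<rho>) l = c *\<^sub>R l)"

text \<open>
  The spectrum of an operator \<open>T\<close> on a real normed space is the spectrum of its complexification: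
  \<open>(u, v)\<close> stands for \<open>u + \<i> v\<close>, and \<open>resolvent_map T z\<close> is \<open>z - T\<close>. A bounded real-linear
  inverse of this map is automatically complex-linear.
\<close>

definition resolvent_map ::
    "('e::real_normed_vector \<Rightarrow>\<^sub>L 'e) \<Rightarrow> complex \<Rightarrow> 'e \<times> 'e \<Rightarrow> 'e \<times> 'e" where
  "resolvent_map T z = (\<lambda>(u, v).
     (Re z *\<^sub>R u - Im z *\<^sub>R v - blinfun_apply T u,
      Im z *\<^sub>R u + Re z *\<^sub>R v - blinfun_apply T v))"

definition op_spectrum :: "('e::real_normed_vector \<Rightarrow>\<^sub>L 'e) \<Rightarrow> complex set" where
  "op_spectrum T =
     {z. \<not> (\<exists>S. bounded_linear S \<and> S \<circ> resolvent_map T z = id \<and> resolvent_map T z \<circ> S = id)}"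

definition op_spectral_radius :: "('e::real_normed_vector \<Rightarrow>\<^sub>L 'e) \<Rightarrow> real" where
  "op_spectral_radius T = (SUP z\<in>op_spectrum T. cmod z)"


section \<open>The subshift and its invariant measures\<close>

definition subst_language :: "('a::topological_space \<Rightarrow> 'a list) \<Rightarrow> 'a list set" where
  "subst_language \<rho> = word_topology closure_of {u. \<exists>n a. sublist u (subst_iter \<rho> n a)}"

definition bi_subword :: "'a list \<Rightarrow> (int \<Rightarrow> 'a) \<Rightarrow> bool" where
  "bi_subword u w \<longleftrightarrow> (\<exists>i. u = map (\<lambda>k. w (i + int k)) [0..<length u])"

definition subshift :: "('a::topological_space \<Rightarrow> 'a list) \<Rightarrow> (int \<Rightarrow> 'a) set" where
  "subshift \<rho> = {w. \<forall>u. bi_subword u w \<longrightarrow> u \<in> subst_language \<rho>}"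

definition shift :: "(int \<Rightarrow> 'a) \<Rightarrow> int \<Rightarrow> 'a" where
  "shift w = (\<lambda>i. w (i + 1))"

text \<open>
  Functions on \<open>X\<close> and functionals on the space of continuous functions on \<open>X\<close> are represented
  extensionally (constantly \<open>undefined\<close> outside their domain), so that equality in HOL is equality
  of functions on the domain. The type \<open>int \<Rightarrow> 'a\<close> carries the product topology.
\<close>

definition cont_functions :: "'x::topological_space set \<Rightarrow> ('x \<Rightarrow> real) set" where
  "cont_functions X = {f \<in> extensional X. continuous_on X f}"

definition positive_functional ::
    "'x::topological_space set \<Rightarrow> (('x \<Rightarrow> real) \<Rightarrow> real) \<Rightarrow> bool" where
  "positive_functional X \<mu> \<longleftrightarrow>
     (\<forall>f\<in>cont_functions X. \<forall>g\<in>cont_functions X. \<mu> (\<lambda>x\<in>X. f x + g x) = \<mu> f + \<mu> g) \<and>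
     (\<forall>c. \<forall>f\<in>cont_functions X. \<mu> (\<lambda>x\<in>X. c * f x) = c * \<mu> f) \<and>
     (\<exists>K. \<forall>f\<in>cont_functions X. \<bar>\<mu> f\<bar> \<le> K * (SUP x\<in>X. \<bar>f x\<bar>)) \<and>
     (\<forall>f\<in>cont_functions X. (\<forall>x\<in>X. 0 \<le> f x) \<longrightarrow> 0 \<le> \<mu> f)"

definition invariant_prob ::
    "(int \<Rightarrow> 'a::topological_space) set \<Rightarrow> (((int \<Rightarrow> 'a) \<Rightarrow> real) \<Rightarrow> real) \<Rightarrow> bool" where
  "invariant_prob X \<mu> \<longleftrightarrow> \<mu> \<in> extensional (cont_functions X) \<and> positive_functional X \<mu> \<and>
     \<mu> (\<lambda>x\<in>X. 1) = 1 \<and> (\<forall>f\<in>cont_functions X. \<mu> (\<lambda>x\<in>X. f (shift x)) = \<mu> f)"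

definition uniquely_ergodic :: "(int \<Rightarrow> 'a::topological_space) set \<Rightarrow> bool" where
  "uniquely_ergodic X \<longleftrightarrow> (\<exists>!\<mu>. invariant_prob X \<mu>)"


section \<open>Well-definedness of the substitution operator\<close>

lemma continuous_map_sum_list:
  fixes f :: "'a::topological_space \<Rightarrow> real"
  assumes f: "continuous_on UNIV f"
  shows "continuous_map word_topology euclidean (\<lambda>u. \<Sum>b\<leftarrow>u. f b)"
proof -
  let ?P = "\<lambda>n::nat. product_topology (\<lambda>_. euclidean :: 'a topology) {..<n}"
  define g :: "nat \<times> (nat \<Rightarrow> 'a) \<Rightarrow> real" where "g = (\<lambda>(n, x). \<Sum>i<n. f (x i))"
  have slice: "continuous_map (?P n) euclidean (\<lambda>x. g (n, x))" for n
  proof -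
    have "continuous_map (?P n) euclidean (\<lambda>x. f (x i))" if "i \<in> {..<n}" for i
      using continuous_map_compose[OF continuous_map_product_projection[OF that], of "\<lambda>_. euclidean" euclidean f] f
      by (simp add: o_def)
    then show ?thesis
      unfolding g_def by (auto intro!: continuous_map_sum)
  qed
  have "continuous_map (sum_topology ?P UNIV) euclidean g"
    unfolding continuous_map_def
  proof (intro conjI allI impI)
    fix U :: "real set" assume U: "openin euclidean U"
    have "openin (?P n) {x \<in> topspace (?P n). g (n, x) \<in> U}" for n
      using slice[of n] U unfolding continuous_map_def by blast
    then show "openin (sum_topology ?P UNIV) {x \<in> topspace (sum_topology ?P UNIV). g x \<in> U}"
      unfolding openin_sum_topology by auto
  qed auto
  then have "continuous_map word_topology euclidean (g \<circ> word_point)"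
    unfolding word_topology_def by (rule continuous_map_pullback)
  moreover have "g \<circ> word_point = (\<lambda>u. \<Sum>b\<leftarrow>u. f b)"
    by (auto simp: fun_eq_iff g_def word_point_def sum_list_sum_nth atLeast0LessThan)
  ultimately show ?thesis by simp
qed

lemma subst_sum_bcontfun:
  fixes \<rho> :: "'a::topological_space \<Rightarrow> 'a list" and f :: "'a \<Rightarrow> real"
  assumes "compact (UNIV :: 'a set)" "continuous_map euclidean word_topology \<rho>"
    and "continuous_on UNIV f"
  shows "(\<lambda>a. \<Sum>b\<leftarrow>\<rho> a. f b) \<in> bcontfun"
proof -
  have "continuous_on UNIV (\<lambda>a. \<Sum>b\<leftarrow>\<rho> a. f b)"
    using continuous_map_compose[OF assms(2) continuous_map_sum_list[OF assms(3)]]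
    by (simp add: o_def)
  then show ?thesis
    using assms(1) by (auto simp: bcontfun_def intro: compact_imp_bounded compact_continuous_image)
qed

lemma subst_op_apply:
  fixes \<rho> :: "'a::topological_space \<Rightarrow> 'a list"
  assumes "compact (UNIV :: 'a set)" "continuous_map euclidean word_topology \<rho>"
  shows "apply_bcontfun (blinfun_apply (subst_op \<rho>) f) a = (\<Sum>b\<leftarrow>\<rho> a. apply_bcontfun f b)"
proof -
  define N where "N = (\<lambda>f :: 'a \<Rightarrow>\<^sub>C real. Bcontfun (\<lambda>a. \<Sum>b\<leftarrow>\<rho> a. apply_bcontfun f b))"
  have M: "apply_bcontfun (N f) a = (\<Sum>b\<leftarrow>\<rho> a. apply_bcontfun f b)" for f a
    unfolding N_def using Bcontfun_inverse[OF subst_sum_bcontfun[OF assms, of "apply_bcontfun f"]] by simp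
  obtain K where K: "\<And>a. real (length (\<rho> a)) \<le> K"
  proof -
    have "bounded (range (\<lambda>a. \<Sum>b\<leftarrow>\<rho> a. 1 :: real))"
      using subst_sum_bcontfun[OF assms, of "\<lambda>_. 1"] by (auto simp: bcontfun_def)
    then show ?thesis
      using that by (auto simp: bounded_iff sum_list_triv)
  qed
  have "bounded_linear N"
  proof (rule bounded_linear_intro)
    fix f g :: "'a \<Rightarrow>\<^sub>C real" and c :: real
    show "N (f + g) = N f + N g"
      by (rule bcontfun_eqI) (simp add: M plus_bcontfun.rep_eq sum_list_addf)
    show "N (c *\<^sub>R f) = c *\<^sub>R N f"
      by (rule bcontfun_eqI) (simp add: M scaleR_bcontfun.rep_eq sum_list_const_mult)
    show "norm (N f) \<le> norm f * K"
    proof (rule norm_bound)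
      fix a
      have "\<bar>\<Sum>b\<leftarrow>u. apply_bcontfun f b\<bar> \<le> real (length u) * norm f" for u
      proof (induction u)
        case (Cons b u)
        have "\<bar>apply_bcontfun f b\<bar> \<le> norm f"
          using norm_bounded[of f b] by simp
        with Cons show ?case by (simp add: algebra_simps)
      qed simp
      from this[of "\<rho> a"] show "norm (apply_bcontfun (N f) a) \<le> norm f * K"
        using mult_right_mono[OF K[of a] norm_ge_zero[of f]] by (simp add: M mult.commute)
    qed
  qed
  then show ?thesis
    unfolding subst_op_def N_def[symmetric] by (simp add: bounded_linear_Blinfun_apply M)
qed

end

theory Submission
  imports Defs
begin

text \<open>
  By irreducibility \<open>l\<close> is bounded away from \<open>0\<close>. Summing \<open>l\<close> over the letters of \<open>\<rho>\<^sup>n a\<close> gives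
  \<open>L ^ n * l a\<close>, where \<open>L\<close> is the eigenvalue of \<open>l\<close>, so \<open>#\<rho>\<^sup>n a\<close> lies between constant multiples of
  \<open>L ^ n\<close>, uniformly in \<open>a\<close>. Hence \<open>L\<close> is the spectral radius, and \<open>L > 1\<close> since words grow.
  The quotient \<open>L ^ n * l a / #\<rho>\<^sup>n a\<close> is the average of \<open>l\<close> over the letters of \<open>\<rho>\<^sup>n a\<close>. Unique
  ergodicity makes such averages converge uniformly: if there were arbitrarily long legal words with
  deviating averages, a cluster point of the corresponding empirical functionals on the full shift
  would be a shift-invariant probability measure supported on the subshift, different from the
  unique one. The limit is positive, and \<open>l\<close> is rescaled by its inverse.
\<close>

section \<open>Uniform letter averages\<close>

text \<open>The closed sets that eventually contain the sequence have the finite intersection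
  property within \<open>C\<close>. A point common to all of them inherits every closed condition
  that eventually holds; this replaces a convergent subsequence, which compactness alone does not
  provide.\<close>

lemma compact_cluster_point:
  fixes f :: "nat \<Rightarrow> 'b::topological_space"
  assumes "compact C" "\<And>k. f k \<in> C"
  obtains x where "x \<in> C" "\<And>P. closed P \<Longrightarrow> eventually (\<lambda>k. f k \<in> P) sequentially \<Longrightarrow> x \<in> P"
proof -
  define \<F> where "\<F> = {P. closed P \<and> eventually (\<lambda>k. f k \<in> P) sequentially}"
  have "C \<inter> \<Inter>\<F> \<noteq> {}"
  proof (rule compact_imp_fip[OF assms(1)])
    fix G assume G: "finite G" "G \<subseteq> \<F>"
    then have "eventually (\<lambda>k. \<forall>P\<in>G. f k \<in> P) sequentially"
      by (auto simp: \<F>_def intro!: eventually_ball_finite)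
    then obtain k where "\<forall>P\<in>G. f k \<in> P"
      by (auto simp: eventually_sequentially)
    with assms(2)[of k] show "C \<inter> \<Inter>G \<noteq> {}" by auto
  qed (auto simp: \<F>_def)
  then show ?thesis
    using that by (auto simp: \<F>_def)
qed

lemma compact_PiE_UNIV:
  fixes S :: "'i \<Rightarrow> 'b::topological_space set"
  assumes "\<And>i. compact (S i)"
  shows "compact (Pi UNIV S)"
proof -
  have "compactin (product_topology (\<lambda>_. euclidean) UNIV) (PiE UNIV S)"
    using assms by (subst compactin_PiE) (auto simp: compactin_euclidean_iff)
  then show ?thesis
    by (simp add: euclidean_product_topology compactin_euclidean_iff PiE_UNIV_domain)
qed

text \<open>A Banach-Alaoglu argument: the sequence lives in the Tychonoff product of the intervals
  \<open>{- norm F..norm F}\<close>. Linearity of the cluster point is obtained later, as one more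
  closed condition.\<close>

lemma functional_cluster_point:
  fixes \<mu> :: "nat \<Rightarrow> 'b::real_normed_vector \<Rightarrow> real"
  assumes "\<And>k F. \<bar>\<mu> k F\<bar> \<le> norm F"
  obtains \<phi> where "\<And>P. closed P \<Longrightarrow> eventually (\<lambda>k. \<mu> k \<in> P) sequentially \<Longrightarrow> \<phi> \<in> P"
proof (rule compact_cluster_point[of "Pi UNIV (\<lambda>F. {- norm F..norm F})" \<mu>])
  show "compact (Pi UNIV (\<lambda>F::'b. {- norm F..norm F}))"
    by (rule compact_PiE_UNIV) auto
  show "\<mu> k \<in> Pi UNIV (\<lambda>F. {- norm F..norm F})" for k
    using assms[of k] by (auto simp: abs_le_iff minus_le_iff)
qed (use that in blast)

section \<open>Windows and the subshift as a closed set\<close>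

text \<open>All these words have length \<open>n\<close>, so the map stays in a single summand of
  the disjoint union, where continuity is checked letter by letter.\<close>

lemma continuous_map_word:
  fixes g :: "'b::topological_space \<Rightarrow> nat \<Rightarrow> 'a::topological_space"
  assumes "\<And>i. continuous_on UNIV (\<lambda>x. g x i)"
  shows "continuous_map euclidean word_topology (\<lambda>x. map (g x) [0..<n])"
proof -
  let ?P = "\<lambda>n::nat. product_topology (\<lambda>_. euclidean :: 'a topology) {..<n}"
  have "continuous_map euclidean (?P n) (\<lambda>x. restrict (g x) {..<n})"
    using assms by (auto simp: continuous_map_componentwise)
  then have "continuous_map euclidean (sum_topology ?P UNIV) (Pair n \<circ> (\<lambda>x. restrict (g x) {..<n}))"
    by (rule continuous_map_compose) (auto intro: continuous_map_component_injection)
  moreover have "Pair n \<circ> (\<lambda>x. restrict (g x) {..<n}) = word_point \<circ> (\<lambda>x. map (g x) [0..<n])"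
    by (auto simp: word_point_def fun_eq_iff restrict_def)
  ultimately show ?thesis
    unfolding word_topology_def by (intro continuous_map_pullback') auto
qed

definition window :: "int \<Rightarrow> nat \<Rightarrow> (int \<Rightarrow> 'a) \<Rightarrow> 'a list" where
  "window i n w = map (\<lambda>k. w (i + int k)) [0..<n]"

lemma continuous_on_shift: "continuous_on S (shift :: (int \<Rightarrow> 'a::topological_space) \<Rightarrow> _)"
proof -
  have "continuous_on UNIV (shift :: (int \<Rightarrow> 'a) \<Rightarrow> _)"
    unfolding shift_def
    by (rule continuous_on_coordinatewise_then_product) (rule continuous_on_product_coordinates)
  then show ?thesis
    by (rule continuous_on_subset) auto
qed

text \<open>Indexing the conditions by position and length presents the subshift as an intersection
  of closed sets, from which a compactness argument can select finitely many.\<close>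

lemma subshift_windows: "subshift \<rho> = (\<Inter>i n. {w. window i n w \<in> subst_language \<rho>})"
proof -
  have *: "bi_subword u w \<longleftrightarrow> (\<exists>i n. u = window i n w)" for u :: "'a list" and w
    unfolding bi_subword_def window_def
    by (metis diff_zero length_map length_upt)
  show ?thesis
    unfolding subshift_def * by blast
qed

lemma closed_window_language:
  fixes \<rho> :: "'a::topological_space \<Rightarrow> 'a list"
  shows "closed {w. window i n w \<in> subst_language \<rho>}"
proof -
  have "continuous_map euclidean word_topology (window i n :: (int \<Rightarrow> 'a) \<Rightarrow> _)"
    unfolding window_def by (rule continuous_map_word) (rule continuous_on_product_coordinates)
  from closedin_continuous_map_preimage[OF this, of "subst_language \<rho>"]
  show ?thesis
    by (simp add: subst_language_def)
qed

lemma closed_subshift: "closed (subshift \<rho>)"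
  unfolding subshift_windows by (intro closed_INT ballI closed_window_language)

lemma shift_in_subshift: "w \<in> subshift \<rho> \<Longrightarrow> shift w \<in> subshift \<rho>"
proof -
  have "window i n (shift w) = window (i + 1) n w" for i n
    by (simp add: window_def shift_def algebra_simps)
  then show "w \<in> subshift \<rho> \<Longrightarrow> shift w \<in> subshift \<rho>"
    by (auto simp: subshift_windows)
qed

lemma factor_in_language:
  assumes "sublist u (subst_iter \<rho> n a)"
  shows "u \<in> subst_language \<rho>"
proof -
  \<comment> \<open>A set is contained in its \<open>closure_of\<close> only as far as it lies in
    the \<open>topspace\<close>.\<close>
  have "topspace (word_topology :: 'a list topology) = UNIV"
    by (auto simp: word_topology_def topspace_pullback_topology word_point_def)
  then have "{u. \<exists>n a. sublist u (subst_iter \<rho> n a)} \<subseteq> subst_language \<rho>"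
    unfolding subst_language_def by (intro closure_of_subset) simp
  with assms show ?thesis
    by blast
qed

section \<open>Averages along words\<close>

text \<open>
  The point of the full shift over which a word \<open>u\<close> is averaged; its letters outside the
  positions \<open>0, \<dots>, #u - 1\<close> are junk, which is harmless because a fixed window misses them at all
  but boundedly many starting positions.
\<close>
definition word_pt :: "'a list \<Rightarrow> nat \<Rightarrow> int \<Rightarrow> 'a" where
  "word_pt u p = (\<lambda>i. u ! nat (i + int p))"

text \<open>Integration of \<open>F\<close> against the empirical measure of the points
  \<open>word_pt u p\<close>. For the empty word the value is 0, by division by zero.\<close>

definition orbit_avg :: "'a list \<Rightarrow> ((int \<Rightarrow> 'a::topological_space) \<Rightarrow>\<^sub>C real) \<Rightarrow> real" where
  "orbit_avg u F = (\<Sum>p<length u. apply_bcontfun F (word_pt u p)) / real (length u)"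

lemma window_word_pt:
  assumes "0 \<le> i + int p" "i + int p + int n \<le> int (length u)"
  shows "sublist (window i n (word_pt u p)) u"
proof -
  have "window i n (word_pt u p) = take n (drop (nat (i + int p)) u)"
    using assms by (intro nth_equalityI) (auto simp: window_def word_pt_def algebra_simps intro!: arg_cong[of _ _ "nth u"])
  then show ?thesis
    by (metis sublist_drop sublist_order.order.trans sublist_take)
qed

lemma orbit_avg_add: "orbit_avg u (F + G) = orbit_avg u F + orbit_avg u G"
  by (simp add: orbit_avg_def sum.distrib add_divide_distrib)

lemma orbit_avg_scaleR: "orbit_avg u (c *\<^sub>R F) = c * orbit_avg u F"
  by (simp add: orbit_avg_def sum_distrib_left)

lemma abs_orbit_avg_le: "\<bar>orbit_avg u F\<bar> \<le> norm F"
proof -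
  have "\<bar>\<Sum>p<length u. apply_bcontfun F (word_pt u p)\<bar> \<le> (\<Sum>p<length u. norm F)"
    using norm_bounded[of F] by (intro order.trans[OF sum_abs] sum_mono) simp
  then show ?thesis
    by (cases "u = []") (auto simp: orbit_avg_def abs_divide field_simps)
qed

text \<open>Shifting moves each averaged point to the next one, so the difference telescopes to two
  boundary values, each of size at most \<open>norm F\<close>.\<close>

lemma orbit_avg_shift:
  assumes "\<And>x. apply_bcontfun G x = apply_bcontfun F (shift x)"
  shows "\<bar>orbit_avg u G - orbit_avg u F\<bar> \<le> 2 * norm F / real (length u)"
proof -
  let ?f = "\<lambda>p. apply_bcontfun F (word_pt u p)"
  have "shift (word_pt u p) = word_pt u (Suc p)" for p
    by (simp add: shift_def word_pt_def fun_eq_iff algebra_simps)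
  then have "orbit_avg u G - orbit_avg u F = (\<Sum>p<length u. ?f (Suc p) - ?f p) / real (length u)"
    by (simp add: orbit_avg_def assms sum_subtractf diff_divide_distrib)
  also have "\<dots> = (?f (length u) - ?f 0) / real (length u)"
    by (simp only: sum_lessThan_telescope[of ?f])
  also have "\<bar>\<dots>\<bar> \<le> 2 * norm F / real (length u)"
    using norm_bounded[of F "word_pt u (length u)"] norm_bounded[of F "word_pt u 0"]
    by (auto simp: abs_divide intro!: divide_right_mono)
  finally show ?thesis .
qed

lemma orbit_avg_letter:
  assumes "\<And>x. apply_bcontfun F x = g (x 0)"
  shows "orbit_avg u F = (\<Sum>b\<leftarrow>u. g b) / real (length u)"
  by (simp add: orbit_avg_def assms word_pt_def sum_list_sum_nth atLeast0LessThan)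

text \<open>Asymptotic positivity. The points with \<open>F\<close> at most
  \<open>- \<delta>\<close> form a compact set that misses the subshift, so finitely many windows
  already exclude them. Where these windows fit inside \<open>u\<close> they are legal, and
  \<open>F\<close> exceeds \<open>- \<delta>\<close>; only boundedly many positions near the ends of
  \<open>u\<close> remain. The bound \<open>B\<close> depends on \<open>F\<close> and
  \<open>\<delta>\<close> but not on \<open>u\<close>.\<close>

lemma orbit_avg_lower_bound:
  fixes \<rho> :: "'a::topological_space \<Rightarrow> 'a list" and F :: "(int \<Rightarrow> 'a) \<Rightarrow>\<^sub>C real"
  assumes comp: "compact (UNIV :: (int \<Rightarrow> 'a) set)"
    and pos: "\<And>x. x \<in> subshift \<rho> \<Longrightarrow> 0 \<le> apply_bcontfun F x" and "\<delta> > 0"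
  obtains B where "\<And>u n a. sublist u (subst_iter \<rho> n a) \<Longrightarrow> u \<noteq> [] \<Longrightarrow>
    - \<delta> - 2 * real B * norm F / real (length u) \<le> orbit_avg u F"
proof -
  define D where "D = {x. apply_bcontfun F x \<le> - \<delta>}"
  define W where "W = (\<lambda>(i, n). {w. window i n w \<in> subst_language \<rho>})"
  have "closed D"
    unfolding D_def by (intro closed_Collect_le) auto
  then have "compact D"
    using comp compact_Int_closed[of UNIV D] by simp
  moreover have "D \<inter> (\<Inter>c\<in>UNIV. W c) = {}"
    using pos \<open>\<delta> > 0\<close> by (force simp: D_def W_def subshift_windows)
  moreover have "closed (W c)" for c
    by (cases c) (simp add: W_def closed_window_language)
  ultimately obtain I where I: "finite I" "D \<inter> (\<Inter>c\<in>I. W c) = {}"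
    using compact_imp_fip_image[of D UNIV W] by blast
  \<comment> \<open>Summing over \<open>I\<close> is a crude way to dominate every single window: at
    distance at least \<open>B\<close> from both ends of \<open>u\<close>, all windows in
    \<open>I\<close> fit.\<close>
  define B where "B = (\<Sum>(i, n)\<in>I. nat \<bar>i\<bar> + n)"
  have B: "nat \<bar>i\<bar> + n \<le> B" if "(i, n) \<in> I" for i n
    unfolding B_def using member_le_sum[OF that, of "\<lambda>(i, n). nat \<bar>i\<bar> + n"] I(1) by auto
  show thesis
  proof (rule that)
    fix u n a assume u: "sublist u (subst_iter \<rho> n a)" "u \<noteq> []"
    define N where "N = length u"
    define bad where "bad = {p. p < N \<and> (p < B \<or> N < p + B)}"
    have "bad \<subseteq> {..<B} \<union> {N - B..<N}"
      by (auto simp: bad_def)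
    then have "card bad \<le> card ({..<B} \<union> {N - B..<N})"
      by (intro card_mono) auto
    also have "\<dots> \<le> 2 * B"
      by (rule order.trans[OF card_Un_le]) auto
    finally have card: "card bad \<le> 2 * B" .
    \<comment> \<open>At a bad position only the trivial bound by \<open>norm F\<close> is
      available.\<close>
    have good: "- \<delta> - (if p \<in> bad then norm F else 0) \<le> apply_bcontfun F (word_pt u p)" if "p < N" for p
    proof (cases "p \<in> bad")
      case True
      then show ?thesis
        using norm_bounded[of F "word_pt u p"] \<open>\<delta> > 0\<close> by simp
    next
      case False
      have "word_pt u p \<in> W c" if "c \<in> I" for c
      proof -
        obtain i m where c: "c = (i, m)" by fastforce
        have "sublist (window i m (word_pt u p)) u"
          using False \<open>p < N\<close> B[of i m] that by (intro window_word_pt) (auto simp: bad_def c N_def)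
        then have "sublist (window i m (word_pt u p)) (subst_iter \<rho> n a)"
          using u(1) by (rule sublist_order.order.trans)
        then show ?thesis
          by (simp add: W_def c factor_in_language)
      qed
      with I(2) have "word_pt u p \<notin> D"
        by blast
      with False show ?thesis
        by (simp add: D_def)
    qed
    have "- \<delta> * N - 2 * real B * norm F \<le> - \<delta> * N - card bad * norm F"
      using mult_right_mono[of "real (card bad)" "2 * real B" "norm F"] card by simp
    also have "\<dots> = (\<Sum>p<N. - \<delta> - (if p \<in> bad then norm F else 0))"
    proof -
      have "{..<N} \<inter> bad = bad"
        by (auto simp: bad_def)
      then show ?thesis
        by (simp add: sum_subtractf sum.If_cases sum_negf)
    qed
    also have "\<dots> \<le> (\<Sum>p<N. apply_bcontfun F (word_pt u p))"
      using good by (intro sum_mono) auto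
    finally have "(- \<delta> * N - 2 * real B * norm F) / N \<le> orbit_avg u F"
      unfolding orbit_avg_def N_def[symmetric] by (rule divide_right_mono) simp
    then show "- \<delta> - 2 * real B * norm F / real (length u) \<le> orbit_avg u F"
      using u(2) by (simp add: N_def diff_divide_distrib)
  qed
qed

section \<open>From functionals on the full shift to measures on the subshift\<close>

lemma Hausdorff_space_euclidean_t2: "Hausdorff_space (euclidean :: 'a::t2_space topology)"
proof -
  have "\<exists>U V. open U \<and> open V \<and> x \<in> U \<and> y \<in> V \<and> disjnt U V" if "x \<noteq> y" for x y :: 'a
    using hausdorff[OF that] unfolding disjnt_def by blast
  then show ?thesis
    by (simp add: Hausdorff_space_def)
qed

lemma Hausdorff_space_full_shift: "Hausdorff_space (euclidean :: (int \<Rightarrow> 'a::t2_space) topology)"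
  using Hausdorff_space_product_topology[of "\<lambda>_. euclidean :: 'a topology" "UNIV :: int set"]
  by (simp add: euclidean_product_topology Hausdorff_space_euclidean_t2)

lemma compact_full_shift:
  assumes "compact (UNIV :: 'a::topological_space set)"
  shows "compact (UNIV :: (int \<Rightarrow> 'a) set)"
  using compact_PiE_UNIV[of "\<lambda>_ :: int. UNIV :: 'a set"] assms by simp

lemma compact_continuous_bcontfun:
  fixes g :: "'x::topological_space \<Rightarrow> real"
  assumes "compact (UNIV :: 'x set)" "continuous_on UNIV g"
  obtains G :: "'x \<Rightarrow>\<^sub>C real" where "\<And>x. apply_bcontfun G x = g x"
proof -
  have "g \<in> bcontfun"
    using assms by (auto simp: bcontfun_def intro: compact_imp_bounded compact_continuous_image)
  with that[of "Bcontfun g"] show ?thesis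
    by (simp add: Bcontfun_inverse)
qed

text \<open>Compact Hausdorff spaces are normal. The extension lets functionals on the full shift be
  evaluated at functions given only on \<open>X\<close>.\<close>

lemma Tietze_compact:
  fixes f :: "'x::topological_space \<Rightarrow> real"
  assumes "compact (UNIV :: 'x set)" "Hausdorff_space (euclidean :: 'x topology)"
    "closed X" "continuous_on X f"
  obtains F :: "'x \<Rightarrow>\<^sub>C real" where "\<And>x. x \<in> X \<Longrightarrow> apply_bcontfun F x = f x"
proof -
  have "normal_space (euclidean :: 'x topology)"
    using assms(1,2) by (intro compact_Hausdorff_or_regular_imp_normal_space)
      (simp_all add: compact_space_def)
  then obtain g where g: "continuous_map euclidean euclideanreal g" "\<And>x. x \<in> X \<Longrightarrow> g x = f x"
    using Tietze_extension_realinterval[of euclidean X UNIV f] assms by auto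
  then have "continuous_on UNIV g"
    by simp
  from compact_continuous_bcontfun[OF assms(1) this] g(2) that show ?thesis
    by metis
qed

text \<open>Since \<open>pos\<close> asks for non-negativity on \<open>X\<close> only,
  \<open>\<phi> F\<close> depends only on the values of \<open>F\<close> on \<open>X\<close>. Hence
  \<open>\<phi>\<close> descends to the continuous functions on \<open>X\<close> through Tietze
  extensions.\<close>

lemma invariant_prob_of_functional:
  fixes X :: "(int \<Rightarrow> 'a::topological_space) set" and \<phi> :: "((int \<Rightarrow> 'a) \<Rightarrow>\<^sub>C real) \<Rightarrow> real"
  assumes comp: "compact (UNIV :: (int \<Rightarrow> 'a) set)"
    and Haus: "Hausdorff_space (euclidean :: (int \<Rightarrow> 'a) topology)"
    and X: "closed X" "\<And>x. x \<in> X \<Longrightarrow> shift x \<in> X"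
    and add: "\<And>F G. \<phi> (F + G) = \<phi> F + \<phi> G"
    and scale: "\<And>c F. \<phi> (c *\<^sub>R F) = c * \<phi> F"
    and pos: "\<And>F. (\<And>x. x \<in> X \<Longrightarrow> 0 \<le> apply_bcontfun F x) \<Longrightarrow> 0 \<le> \<phi> F"
    and one: "\<phi> (const_bcontfun 1) = 1"
    and inv: "\<And>F G. (\<And>x. apply_bcontfun G x = apply_bcontfun F (shift x)) \<Longrightarrow> \<phi> G = \<phi> F"
  obtains \<nu> where "invariant_prob X \<nu>" "\<And>F. \<nu> (restrict (apply_bcontfun F) X) = \<phi> F"
proof -
  have mono: "\<phi> F \<le> \<phi> G" if "\<And>x. x \<in> X \<Longrightarrow> apply_bcontfun F x \<le> apply_bcontfun G x" for F G
  proof -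
    have "0 \<le> \<phi> (G + (-1) *\<^sub>R F)"
      using that by (intro pos) simp
    then show ?thesis
      unfolding add scale by simp
  qed
  have cong: "\<phi> F = \<phi> G" if "\<And>x. x \<in> X \<Longrightarrow> apply_bcontfun F x = apply_bcontfun G x" for F G
    using mono[of F G] mono[of G F] that by simp
  \<comment> \<open>On an empty \<open>X\<close>, \<open>cong\<close> would identify the constants 1
    and 2.\<close>
  have "X \<noteq> {}"
    using cong[of "const_bcontfun 1" "2 *\<^sub>R const_bcontfun 1"] by (auto simp: scale one)
  \<comment> \<open>An arbitrary choice of extension, not linear in \<open>f\<close>;
    \<open>cong\<close> makes \<open>\<phi> (E f)\<close> independent of it.\<close>
  define E where "E f = (SOME F :: (int \<Rightarrow> 'a) \<Rightarrow>\<^sub>C real. \<forall>x\<in>X. apply_bcontfun F x = f x)" for f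
  have E: "apply_bcontfun (E f) x = f x" if "f \<in> cont_functions X" "x \<in> X" for f x
  proof -
    have "\<exists>F :: (int \<Rightarrow> 'a) \<Rightarrow>\<^sub>C real. \<forall>x\<in>X. apply_bcontfun F x = f x"
      using Tietze_compact[OF comp Haus X(1), of f] that unfolding cont_functions_def
      by (metis (mono_tags, lifting) mem_Collect_eq)
    from someI_ex[OF this] show ?thesis
      using that by (simp add: E_def)
  qed
  have contI: "restrict g X \<in> cont_functions X" if "continuous_on X g" for g
    using that by (simp add: cont_functions_def cong: continuous_on_cong)
  define \<nu> where "\<nu> = restrict (\<lambda>f. \<phi> (E f)) (cont_functions X)"
  have \<nu>I: "\<nu> f = \<phi> F" if "f \<in> cont_functions X" "\<And>x. x \<in> X \<Longrightarrow> f x = apply_bcontfun F x" for f F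
    using that E by (auto simp: \<nu>_def intro!: cong)
  have cont: "continuous_on X f" if "f \<in> cont_functions X" for f
    using that by (simp add: cont_functions_def)
  have "invariant_prob X \<nu>"
    unfolding invariant_prob_def positive_functional_def
  proof (intro conjI ballI allI impI exI)
    show "\<nu> \<in> extensional (cont_functions X)"
      by (simp add: \<nu>_def)
  next
    fix f g assume f: "f \<in> cont_functions X" and g: "g \<in> cont_functions X"
    have "\<nu> (\<lambda>x\<in>X. f x + g x) = \<phi> (E f + E g)"
      using f g by (intro \<nu>I contI continuous_intros cont) (simp_all add: E)
    then show "\<nu> (\<lambda>x\<in>X. f x + g x) = \<nu> f + \<nu> g"
      using f g by (simp add: add \<nu>_def)
  next
    fix c f assume f: "f \<in> cont_functions X"
    have "\<nu> (\<lambda>x\<in>X. c * f x) = \<phi> (c *\<^sub>R E f)"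
      using f by (intro \<nu>I contI continuous_intros cont) (simp_all add: E)
    then show "\<nu> (\<lambda>x\<in>X. c * f x) = c * \<nu> f"
      using f by (simp add: scale \<nu>_def)
  next
    fix f assume f: "f \<in> cont_functions X"
    define s where "s = (SUP x\<in>X. \<bar>f x\<bar>)"
    have bdd: "\<bar>f x\<bar> \<le> s" if "x \<in> X" for x
      unfolding s_def
    proof (rule cSUP_upper[OF that])
      show "bdd_above ((\<lambda>x. \<bar>f x\<bar>) ` X)"
        using norm_bounded[of "E f"] E[OF f] by (auto intro!: bdd_aboveI[of _ "norm (E f)"]) (metis real_norm_def)
    qed
    \<comment> \<open>Comparison with the constants \<open>s\<close> and \<open>- s\<close>,
      together with \<open>one\<close>, gives continuity with constant 1.\<close>
    have "\<phi> (E f) \<le> \<phi> (s *\<^sub>R const_bcontfun 1)" "\<phi> ((- s) *\<^sub>R const_bcontfun 1) \<le> \<phi> (E f)"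
      using bdd by (auto intro!: mono simp: E f abs_le_iff const_bcontfun.rep_eq minus_le_iff)
    then show "\<bar>\<nu> f\<bar> \<le> 1 * (SUP x\<in>X. \<bar>f x\<bar>)"
      unfolding scale one using f by (simp add: \<nu>_def s_def[symmetric])
  next
    fix f assume f: "f \<in> cont_functions X" "\<forall>x\<in>X. 0 \<le> f x"
    then show "0 \<le> \<nu> f"
      by (auto simp: \<nu>_def E intro!: pos)
  next
    have "\<nu> (\<lambda>x\<in>X. 1) = \<phi> (const_bcontfun 1)"
      by (intro \<nu>I contI continuous_intros) (simp_all add: const_bcontfun.rep_eq)
    then show "\<nu> (\<lambda>x\<in>X. 1) = 1"
      by (simp add: one)
  next
    fix f assume f: "f \<in> cont_functions X"
    obtain G where G: "\<And>x. apply_bcontfun G x = apply_bcontfun (E f) (shift x)"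
      using compact_continuous_bcontfun[OF comp, of "\<lambda>x. apply_bcontfun (E f) (shift x)"]
        continuous_on_compose[OF continuous_on_shift, of UNIV "apply_bcontfun (E f)"]
      by (auto simp: o_def)
    have "\<nu> (\<lambda>x\<in>X. f (shift x)) = \<phi> G"
      using X(2) f
      by (intro \<nu>I contI continuous_on_compose2[OF cont[OF f] continuous_on_shift]) (auto simp: G E)
    also have "\<dots> = \<nu> f"
      using inv[OF G] f by (simp add: \<nu>_def)
    finally show "\<nu> (\<lambda>x\<in>X. f (shift x)) = \<nu> f" .
  qed
  moreover have "\<nu> (restrict (apply_bcontfun F) X) = \<phi> F" for F
    by (intro \<nu>I contI) simp_all
  ultimately show ?thesis
    using that by blast
qed

text \<open>The limit \<open>m\<close> is the value of the unique invariant functional at the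
  function that applies \<open>g\<close> to the letter at position 0.\<close>

proposition uniform_letter_averages:
  fixes \<rho> :: "'a::t2_space \<Rightarrow> 'a list" and g :: "'a \<Rightarrow> real"
  assumes compA: "compact (UNIV :: 'a set)" and g: "continuous_on UNIV g"
    and ue: "uniquely_ergodic (subshift \<rho>)"
  obtains m where "\<And>\<epsilon>. \<epsilon> > 0 \<Longrightarrow> \<exists>K. \<forall>u n a. sublist u (subst_iter \<rho> n a) \<longrightarrow> K \<le> length u \<longrightarrow>
    \<bar>(\<Sum>b\<leftarrow>u. g b) / real (length u) - m\<bar> \<le> \<epsilon>"
proof -
  let ?X = "subshift \<rho>"
  note comp = compact_full_shift[OF compA]
  obtain F0 :: "(int \<Rightarrow> 'a) \<Rightarrow>\<^sub>C real" where F0: "\<And>x. apply_bcontfun F0 x = g (x 0)"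
    using compact_continuous_bcontfun[OF comp, of "\<lambda>x. g (x 0)"]
      continuous_on_compose2[OF g continuous_on_product_coordinates[of 0]] by auto
  obtain \<mu> where \<mu>: "\<And>\<nu>. invariant_prob ?X \<nu> \<Longrightarrow> \<nu> = \<mu>"
    using ue unfolding uniquely_ergodic_def by blast
  define m where "m = \<mu> (restrict (apply_bcontfun F0) ?X)"
  show thesis
  proof (rule that[of m], rule ccontr)
    fix \<epsilon> :: real
    assume "\<epsilon> > 0" and "\<nexists>K. \<forall>u n a. sublist u (subst_iter \<rho> n a) \<longrightarrow> K \<le> length u \<longrightarrow>
      \<bar>(\<Sum>b\<leftarrow>u. g b) / real (length u) - m\<bar> \<le> \<epsilon>"
    \<comment> \<open>\<open>Suc K\<close> instead of \<open>K\<close> makes every witness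
      non-empty.\<close>
    then have "\<forall>K. \<exists>u. (\<exists>n a. sublist u (subst_iter \<rho> n a)) \<and> Suc K \<le> length u \<and>
      \<epsilon> < \<bar>(\<Sum>b\<leftarrow>u. g b) / real (length u) - m\<bar>"
      by (meson not_le)
    then obtain u where u: "\<And>K. \<exists>n a. sublist (u K) (subst_iter \<rho> n a)"
      and len: "\<And>K. Suc K \<le> length (u K)"
      and dev: "\<And>K. \<epsilon> < \<bar>(\<Sum>b\<leftarrow>u K. g b) / real (length (u K)) - m\<bar>"
      by metis
    define avg where "avg K = orbit_avg (u K)" for K
    obtain \<phi> where \<phi>: "\<And>P. closed P \<Longrightarrow> eventually (\<lambda>k. avg k \<in> P) sequentially \<Longrightarrow> \<phi> \<in> P"
      using functional_cluster_point[of avg] abs_orbit_avg_le by (metis avg_def)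
    \<comment> \<open>Boundary errors of the form constant over length vanish along the
      sequence.\<close>
    have small: "\<exists>K0. \<forall>K\<ge>K0. C / real (length (u K)) \<le> \<delta>" if "\<delta> > 0" "C \<ge> 0" for C \<delta> :: real
    proof -
      obtain K0 :: nat where "C / \<delta> \<le> real K0"
        using real_arch_simple by blast
      then have "C \<le> \<delta> * real (length (u K))" if "K \<ge> K0" for K
      proof -
        have "\<delta> * real K0 \<le> \<delta> * real (length (u K))"
          using len[of K] that \<open>\<delta> > 0\<close> by (intro mult_left_mono) auto
        moreover have "C \<le> \<delta> * real K0"
          using \<open>C / \<delta> \<le> real K0\<close> \<open>\<delta> > 0\<close> by (simp add: field_simps)
        ultimately show ?thesis
          by linarith
      qed
      moreover have "0 < length (u K)" for K
        using len[of K] by linarith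
      ultimately show ?thesis
        by (metis divide_le_eq of_nat_0_less_iff)
    qed
    obtain \<nu> where \<nu>: "invariant_prob ?X \<nu>" "\<And>F. \<nu> (restrict (apply_bcontfun F) ?X) = \<phi> F"
    proof (rule invariant_prob_of_functional[OF comp Hausdorff_space_full_shift closed_subshift[of \<rho>], of \<phi>])
      fix F G
      \<comment> \<open>Evaluation at a fixed function is continuous in the product topology, so
        each identity is a closed condition and passes from the averages to
        \<open>\<phi>\<close>.\<close>
      have "\<phi> \<in> {f. f (F + G) = f F + f G}"
        by (rule \<phi>) (auto intro!: closed_Collect_eq continuous_intros continuous_on_product_coordinates
            simp: avg_def orbit_avg_add)
      then show "\<phi> (F + G) = \<phi> F + \<phi> G" by simp
    next
      fix c F
      have "\<phi> \<in> {f. f (c *\<^sub>R F) = c * f F}"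
        by (rule \<phi>) (auto intro!: closed_Collect_eq continuous_intros continuous_on_product_coordinates
            simp: avg_def orbit_avg_scaleR)
      then show "\<phi> (c *\<^sub>R F) = c * \<phi> F" by simp
    next
      have "avg K (const_bcontfun 1) = 1" for K
        using len[of K] by (auto simp: avg_def orbit_avg_def const_bcontfun.rep_eq)
      then have "\<phi> \<in> {f. f (const_bcontfun 1) = 1}"
        by (intro \<phi>) (auto intro!: closed_Collect_eq continuous_intros continuous_on_product_coordinates)
      then show "\<phi> (const_bcontfun 1) = 1" by simp
    next
      fix F :: "(int \<Rightarrow> 'a) \<Rightarrow>\<^sub>C real"
      assume pos: "\<And>x. x \<in> ?X \<Longrightarrow> 0 \<le> apply_bcontfun F x"
      \<comment> \<open>The averages are non-negative only up to an error, so closedness is applied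
        for each \<open>\<delta>\<close> separately.\<close>
      have nearly: "- \<delta> \<le> \<phi> F" if "\<delta> > 0" for \<delta>
      proof -
        obtain B where B: "\<And>u n a. sublist u (subst_iter \<rho> n a) \<Longrightarrow> u \<noteq> [] \<Longrightarrow>
            - (\<delta> / 2) - 2 * real B * norm F / real (length u) \<le> orbit_avg u F"
          using orbit_avg_lower_bound[OF comp pos half_gt_zero[OF \<open>\<delta> > 0\<close>]] by blast
        obtain K0 where K0: "\<forall>K\<ge>K0. 2 * real B * norm F / real (length (u K)) \<le> \<delta> / 2"
          using small[of "\<delta> / 2" "2 * real B * norm F"] \<open>\<delta> > 0\<close> by auto
        have "- \<delta> \<le> avg K F" if "K \<ge> K0" for K
        proof -
          obtain n a where "sublist (u K) (subst_iter \<rho> n a)"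
            using u by blast
          moreover have "u K \<noteq> []"
            using len[of K] by (cases "u K") auto
          ultimately show ?thesis
            using B[of "u K" n a] K0[rule_format, OF that] by (simp add: avg_def)
        qed
        then have "\<phi> \<in> {f. - \<delta> \<le> f F}"
          by (intro \<phi>) (auto intro!: closed_Collect_le continuous_intros continuous_on_product_coordinates
              simp: eventually_sequentially)
        then show ?thesis by simp
      qed
      show "0 \<le> \<phi> F"
      proof (rule field_le_epsilon)
        show "0 \<le> \<phi> F + \<delta>" if "\<delta> > 0" for \<delta>
          using nearly[OF that] by simp
      qed
    next
      fix F G :: "(int \<Rightarrow> 'a) \<Rightarrow>\<^sub>C real"
      assume G: "\<And>x. apply_bcontfun G x = apply_bcontfun F (shift x)"
      have nearly: "\<bar>\<phi> G - \<phi> F\<bar> \<le> \<delta>" if "\<delta> > 0" for \<delta>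
      proof -
        obtain K0 where K0: "\<forall>K\<ge>K0. 2 * norm F / real (length (u K)) \<le> \<delta>"
          using small[of \<delta> "2 * norm F"] \<open>\<delta> > 0\<close> by auto
        have "\<bar>avg K G - avg K F\<bar> \<le> \<delta>" if "K \<ge> K0" for K
          using order.trans[OF orbit_avg_shift[OF G, of "u K"] K0[rule_format, OF that]]
          by (simp add: avg_def)
        then have "\<phi> \<in> {f. \<bar>f G - f F\<bar> \<le> \<delta>}"
          by (intro \<phi>) (auto intro!: closed_Collect_le continuous_intros continuous_on_product_coordinates
              simp: eventually_sequentially)
        then show ?thesis by simp
      qed
      have "\<bar>\<phi> G - \<phi> F\<bar> \<le> 0"
        by (rule field_le_epsilon) (simp add: nearly)
      then show "\<phi> G = \<phi> F"
        by simp
    qed (auto intro: shift_in_subshift)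
    \<comment> \<open>The deviation from \<open>m\<close> is a closed condition as well, so it
      survives in \<open>\<phi>\<close>, against uniqueness.\<close>
    have "\<epsilon> \<le> \<bar>avg K F0 - m\<bar>" for K
      using dev[of K] unfolding avg_def orbit_avg_letter[of F0 g, OF F0] by simp
    then have "\<phi> \<in> {f. \<epsilon> \<le> \<bar>f F0 - m\<bar>}"
      by (intro \<phi>) (auto intro!: closed_Collect_le continuous_intros continuous_on_product_coordinates)
    moreover have "\<phi> F0 = m"
      using \<nu> \<mu> by (simp add: m_def)
    ultimately show False
      using \<open>\<epsilon> > 0\<close> by simp
  qed
qed


section \<open>The spectral radius\<close>

text \<open>The library instance requires a metric domain, which the alphabet does not have.\<close>
lemma bcontfun_Cauchy_convergent:
  fixes f :: "nat \<Rightarrow> 'a::topological_space \<Rightarrow>\<^sub>C 'b::complete_space"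
  assumes "Cauchy f"
  shows "convergent f"
proof -
  have "uniformly_convergent_on UNIV (\<lambda>n. apply_bcontfun (f n))"
  proof (intro Cauchy_uniformly_convergent uniformly_Cauchy_onI)
    fix e :: real assume "e > 0"
    with assms obtain M where "\<forall>m\<ge>M. \<forall>n\<ge>M. dist (f m) (f n) < e"
      unfolding Cauchy_def by blast
    then show "\<exists>M. \<forall>x\<in>UNIV. \<forall>m\<ge>M. \<forall>n\<ge>M.
        dist (apply_bcontfun (f m) x) (apply_bcontfun (f n) x) < e"
      by (meson dist_fun_lt_imp_dist_val_lt)
  qed
  then obtain g where "uniform_limit UNIV (\<lambda>n. apply_bcontfun (f n)) g sequentially"
    unfolding uniformly_convergent_on_def by blast
  from uniform_limit_bcontfunE[OF this sequentially_bot] show ?thesis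
    by (metis convergentI)
qed

lemma Cauchy_convergent_prod:
  fixes X :: "nat \<Rightarrow> 'e::metric_space \<times> 'e"
  assumes complete: "\<And>Y :: nat \<Rightarrow> 'e. Cauchy Y \<Longrightarrow> convergent Y" and "Cauchy X"
  shows "convergent X"
proof -
  have "Cauchy (\<lambda>n. fst (X n))" "Cauchy (\<lambda>n. snd (X n))"
    using \<open>Cauchy X\<close> unfolding Cauchy_def by (meson dist_fst_le dist_snd_le order.strict_trans1)+
  then obtain a b where "(\<lambda>n. fst (X n)) \<longlonglongrightarrow> a" "(\<lambda>n. snd (X n)) \<longlonglongrightarrow> b"
    using complete by (meson convergent_def)
  from tendsto_Pair[OF this] show ?thesis
    by (auto simp: convergent_def)
qed

text \<open>Differences of partial sums are dominated by those of the geometric series, so the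
  partial sums are Cauchy.\<close>

lemma geometric_bound_summable:
  fixes f :: "nat \<Rightarrow> 'b::real_normed_vector"
  assumes complete: "\<And>X :: nat \<Rightarrow> 'b. Cauchy X \<Longrightarrow> convergent X"
    and bound: "\<And>n. norm (f n) \<le> K * q ^ n" and q: "0 \<le> q" "q < 1"
  shows "summable f" "norm (suminf f) \<le> K * (1 / (1 - q))"
proof -
  have geo: "(\<lambda>n. K * q ^ n) sums (K * (1 / (1 - q)))"
    using q by (intro sums_mult geometric_sums) simp
  then have "Cauchy (\<lambda>n. \<Sum>k<n. K * q ^ k)"
    by (auto simp: sums_def intro: LIMSEQ_imp_Cauchy)
  have diff: "norm ((\<Sum>k<m. f k) - (\<Sum>k<n. f k)) \<le> norm ((\<Sum>k<m. K * q ^ k) - (\<Sum>k<n. K * q ^ k))"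
    if "m < n" for m n
  proof -
    have split: "(\<Sum>k<n. g k) = (\<Sum>k<m. g k) + (\<Sum>k=m..<n. g k)" for g :: "nat \<Rightarrow> 'c::real_normed_vector"
      using that by (simp add: lessThan_atLeast0 sum.atLeastLessThan_concat)
    have "norm (\<Sum>k=m..<n. f k) \<le> (\<Sum>k=m..<n. K * q ^ k)"
      by (rule sum_norm_le) (rule bound)
    then show ?thesis
      by (simp add: split[of f] split[of "\<lambda>k. K * q ^ k"])
  qed
  have "Cauchy (\<lambda>n. \<Sum>k<n. f k)"
  proof (rule CauchyI')
    fix e :: real assume "0 < e"
    from CauchyD[OF \<open>Cauchy (\<lambda>n. \<Sum>k<n. K * q ^ k)\<close> this] diff
    show "\<exists>M. \<forall>m\<ge>M. \<forall>n>m. dist (\<Sum>k<m. f k) (\<Sum>k<n. f k) < e"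
      unfolding dist_norm by (meson le_less_trans less_imp_le order.trans)
  qed
  from complete[OF this] show summ: "summable f"
    by (simp add: summable_iff_convergent)
  have "norm (\<Sum>k<n. f k) \<le> K * (1 / (1 - q))" for n
  proof -
    have "norm (\<Sum>k<n. f k) \<le> (\<Sum>k<n. K * q ^ k)"
      by (rule sum_norm_le) (rule bound)
    also have "\<dots> \<le> (\<Sum>k. K * q ^ k)"
      using sums_summable[OF geo] order.trans[OF norm_ge_zero bound] by (intro sum_le_suminf) auto
    finally show ?thesis
      using sums_unique[OF geo] by simp
  qed
  with summable_LIMSEQ[OF summ] show "norm (suminf f) \<le> K * (1 / (1 - q))"
    by (intro Lim_norm_ubound[of sequentially]) auto
qed

section \<open>Complexification and the Neumann series\<close>

text \<open>Complex scalar multiplication, with the pair read as real and imaginary part.\<close>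

definition cmul :: "complex \<Rightarrow> 'e::real_normed_vector \<times> 'e \<Rightarrow> 'e \<times> 'e" where
  "cmul w = (\<lambda>(u, v). (Re w *\<^sub>R u - Im w *\<^sub>R v, Im w *\<^sub>R u + Re w *\<^sub>R v))"

definition complexify :: "('e::real_normed_vector \<Rightarrow>\<^sub>L 'e) \<Rightarrow> 'e \<times> 'e \<Rightarrow> 'e \<times> 'e" where
  "complexify T = (\<lambda>(u, v). (blinfun_apply T u, blinfun_apply T v))"

lemma resolvent_map_eq: "resolvent_map T z x = cmul z x - complexify T x"
  by (cases x) (simp add: resolvent_map_def cmul_def complexify_def)

lemma cmul_cmul: "cmul w (cmul z x) = cmul (w * z) x"
  by (cases x) (simp add: cmul_def algebra_simps)

lemma cmul_1: "cmul 1 x = x"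
  by (cases x) (simp add: cmul_def)

lemma cmul_diff: "cmul w (x - y) = cmul w x - cmul w y"
  by (cases x; cases y) (simp add: cmul_def algebra_simps)

lemma cmul_complexify: "complexify T (cmul w x) = cmul w (complexify T x)"
  by (cases x) (simp add: cmul_def complexify_def blinfun.bilinear_simps)

text \<open>The 4 counts the four real products; the argument tolerates any constant.\<close>

lemma norm_cmul: "norm (cmul w x) \<le> 4 * cmod w * norm x"
proof (cases x)
  case (Pair u v)
  have uv: "norm u \<le> norm x" "norm v \<le> norm x"
    using norm_fst_le[of u v] norm_snd_le[of v u] by (auto simp: Pair)
  have *: "norm (c *\<^sub>R y) \<le> cmod w * norm x"
    if "\<bar>c\<bar> \<le> cmod w" "norm y \<le> norm x" for c and y :: 'a
    using that by (auto intro!: mult_mono)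
  have "norm (cmul w x) \<le> norm (Re w *\<^sub>R u - Im w *\<^sub>R v) + norm (Im w *\<^sub>R u + Re w *\<^sub>R v)"
    unfolding Pair cmul_def using norm_Pair_le by auto
  also have "\<dots> \<le> (norm (Re w *\<^sub>R u) + norm (Im w *\<^sub>R v)) + (norm (Im w *\<^sub>R u) + norm (Re w *\<^sub>R v))"
    by (intro add_mono norm_triangle_ineq4 norm_triangle_ineq)
  also have "\<dots> \<le> 4 * (cmod w * norm x)"
    using *[OF abs_Re_le_cmod uv(1)] *[OF abs_Im_le_cmod uv(2)]
      *[OF abs_Im_le_cmod uv(1)] *[OF abs_Re_le_cmod uv(2)] by linarith
  finally show ?thesis by simp
qed

lemma bounded_linear_cmul: "bounded_linear (cmul w)"
proof (rule bounded_linear_intro)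
  show "norm (cmul w x) \<le> norm x * (4 * cmod w)" for x
    using norm_cmul[of w x] by (simp add: mult_ac)
qed (auto simp: cmul_def split_def algebra_simps)

lemma bounded_linear_complexify: "bounded_linear (complexify T)"
  unfolding complexify_def split_def
  by (intro bounded_linear_Pair bounded_linear_compose[OF blinfun.bounded_linear_right]
      bounded_linear_fst bounded_linear_snd)

lemma complexify_funpow: "(complexify T ^^ n) x =
    ((blinfun_apply T ^^ n) (fst x), (blinfun_apply T ^^ n) (snd x))"
  by (induction n) (auto simp: complexify_def split_def)

lemma norm_complexify_funpow:
  assumes "\<And>x. norm ((blinfun_apply T ^^ n) x) \<le> K * norm x" "0 \<le> K"
  shows "norm ((complexify T ^^ n) x) \<le> 2 * K * norm x"
proof -
  have "norm ((complexify T ^^ n) x) \<le> K * norm (fst x) + K * norm (snd x)"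
    unfolding complexify_funpow
    by (rule order.trans[OF norm_Pair_le add_mono[OF assms(1) assms(1)]])
  also have "\<dots> \<le> K * norm x + K * norm x"
    using norm_fst_le[of "fst x" "snd x"] norm_snd_le[of "snd x" "fst x"] assms(2)
    by (intro add_mono mult_left_mono) auto
  finally show ?thesis by simp
qed

text \<open>The inverse of \<open>z - T\<close> is the Neumann series \<open>\<Sum>n. z powi - (n + 1) T ^ n\<close>.\<close>
proposition not_in_spectrum:
  fixes T :: "'e::real_normed_vector \<Rightarrow>\<^sub>L 'e"
  assumes complete: "\<And>X :: nat \<Rightarrow> 'e. Cauchy X \<Longrightarrow> convergent X"
    and bound: "\<And>n x. norm ((blinfun_apply T ^^ n) x) \<le> C * L ^ n * norm x"
    and "0 \<le> C" "0 \<le> L" "L < cmod z"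
  shows "z \<notin> op_spectrum T"
proof -
  let ?A = "complexify T" and ?R = "resolvent_map T z"
  interpret A: bounded_linear ?A by (rule bounded_linear_complexify)
  have z: "z \<noteq> 0" using assms by auto
  define t where "t n x = cmul (1 / z ^ Suc n) ((?A ^^ n) x)" for n x
  define q where "q = L / cmod z"
  have q: "0 \<le> q" "q < 1" using assms by (auto simp: q_def divide_less_eq)
  \<comment> \<open>The 8 is 4 from \<open>norm_cmul\<close> times 2 from
    \<open>norm_complexify_funpow\<close>.\<close>
  define D where "D = 8 * C"
  have norm_term: "norm (cmul (1 / z ^ n) ((?A ^^ n) x)) \<le> D * norm x * q ^ n" for n x
  proof -
    have "norm (cmul (1 / z ^ n) ((?A ^^ n) x)) \<le> 4 * cmod (1 / z ^ n) * (2 * (C * L ^ n) * norm x)"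
      using norm_complexify_funpow[where T=T and n=n and K="C * L ^ n" and x=x] bound assms
      by (intro order.trans[OF norm_cmul] mult_left_mono) auto
    then show ?thesis
      by (simp add: D_def q_def norm_divide norm_power power_divide mult_ac)
  qed
  have t_alt: "t n x = cmul (1 / z) (cmul (1 / z ^ n) ((?A ^^ n) x))" for n x
    by (simp add: t_def cmul_cmul)
  have norm_t: "norm (t n x) \<le> 4 * cmod (1 / z) * (D * norm x) * q ^ n" for n x
    unfolding t_alt using norm_term[of n x]
    by (intro order.trans[OF norm_cmul]) (auto intro!: divide_right_mono mult_left_mono simp: mult.assoc)
  note geometric = geometric_bound_summable[OF Cauchy_convergent_prod[OF complete] norm_t q]
  note summ = geometric(1)
  define S where "S x = (\<Sum>n. t n x)" for x
  have lin: "bounded_linear (t n)" for n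
    unfolding t_def
  proof (rule bounded_linear_compose[OF bounded_linear_cmul])
    show "bounded_linear (?A ^^ n)"
    proof (induction n)
      case (Suc n)
      then show ?case
        using bounded_linear_compose[OF bounded_linear_complexify] by (simp add: o_def)
    qed (simp add: id_def bounded_linear_ident)
  qed
  have S: "bounded_linear S"
  proof (rule bounded_linear_intro)
    fix x y :: "'e \<times> 'e" and c :: real
    show "S (x + y) = S x + S y"
      using summ by (simp add: S_def linear_add[OF bounded_linear.linear[OF lin]] suminf_add)
    show "S (c *\<^sub>R x) = c *\<^sub>R S x"
      using summ by (simp add: S_def linear_scale[OF bounded_linear.linear[OF lin]] bounded_linear.suminf[OF bounded_linear_scaleR_right])
    show "norm (S x) \<le> norm x * (4 * cmod (1 / z) * D * (1 / (1 - q)))"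
      using geometric(2)[of x] by (simp add: S_def mult_ac)
  qed
  have R: "bounded_linear ?R"
    unfolding resolvent_map_eq[abs_def]
    by (intro bounded_linear_sub bounded_linear_cmul bounded_linear_complexify)
  \<comment> \<open>The resolvent map turns the series into a telescoping one whose first term is
    \<open>x\<close>.\<close>
  have Rt: "?R (t n x) = cmul (1 / z ^ n) ((?A ^^ n) x) - cmul (1 / z ^ Suc n) ((?A ^^ Suc n) x)" for n x
    using z by (simp add: resolvent_map_eq t_def cmul_cmul cmul_complexify)
  \<comment> \<open>Each term commutes with the resolvent map, so the left inverse reduces to the
    same telescoping sum as the right one.\<close>
  have tR: "t n (?R x) = ?R (t n x)" for n x
  proof -
    have "(?A ^^ n) (?R x) = cmul z ((?A ^^ n) x) - (?A ^^ Suc n) x"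
      by (induction n) (simp_all add: resolvent_map_eq A.diff cmul_complexify)
    then show ?thesis
      using z unfolding Rt by (simp add: t_def cmul_diff cmul_cmul)
  qed
  have RS: "?R (S x) = x" and SR: "S (?R x) = x" for x
  proof -
    have "(\<lambda>n. D * norm x * q ^ n) \<longlonglongrightarrow> 0"
      using q by (intro tendsto_mult_right_zero LIMSEQ_realpow_zero)
    then have "(\<lambda>n. cmul (1 / z ^ n) ((?A ^^ n) x)) \<longlonglongrightarrow> 0"
      by (rule Lim_null_comparison[rotated]) (auto simp: norm_term)
    from telescope_sums'[OF this] have "(\<lambda>n. ?R (t n x)) sums x"
      unfolding Rt by (simp add: cmul_1)
    then have *: "(\<Sum>n. ?R (t n x)) = x"
      by (rule sums_unique[symmetric])
    then show "?R (S x) = x"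
      unfolding S_def by (simp add: bounded_linear.suminf[OF R summ])
    from * show "S (?R x) = x"
      by (simp add: S_def tR)
  qed
  then have "bounded_linear S \<and> S \<circ> ?R = id \<and> ?R \<circ> S = id"
    using S by (auto simp: fun_eq_iff)
  then show ?thesis
    unfolding op_spectrum_def by blast
qed

text \<open>The resolvent map sends both \<open>(x, 0)\<close> and 0 to 0, so it has no left
  inverse.\<close>

lemma eigenvalue_in_spectrum:
  assumes "blinfun_apply T x = c *\<^sub>R x" "x \<noteq> 0"
  shows "complex_of_real c \<in> op_spectrum T"
proof -
  have "resolvent_map T (complex_of_real c) (x, 0) = 0"
    "resolvent_map T (complex_of_real c) 0 = 0"
    using assms by (simp_all add: resolvent_map_def blinfun.bilinear_simps zero_prod_def)
  then have "\<not> S \<circ> resolvent_map T (complex_of_real c) = id" for S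
    using assms(2) by (metis comp_apply id_apply prod.inject zero_prod_def)
  then show ?thesis
    by (auto simp: op_spectrum_def)
qed

text \<open>The power bound confines the spectrum to the disc of radius \<open>L\<close>, and the
  eigenvalue \<open>L\<close> lies on its boundary.\<close>

lemma spectral_radius_eigenvalue:
  fixes T :: "'e::real_normed_vector \<Rightarrow>\<^sub>L 'e"
  assumes "\<And>X :: nat \<Rightarrow> 'e. Cauchy X \<Longrightarrow> convergent X"
    and "\<And>n x. norm ((blinfun_apply T ^^ n) x) \<le> C * L ^ n * norm x" "0 \<le> C" "0 \<le> L"
    and "blinfun_apply T x = L *\<^sub>R x" "x \<noteq> 0"
  shows "op_spectral_radius T = L"
  unfolding op_spectral_radius_def
proof (rule cSup_eq_maximum)
  have "cmod (complex_of_real L) \<in> cmod ` op_spectrum T"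
    using eigenvalue_in_spectrum[OF assms(5,6)] by blast
  then show "L \<in> cmod ` op_spectrum T"
    using assms(4) by simp
  show "y \<le> L" if "y \<in> cmod ` op_spectrum T" for y
  proof (rule ccontr)
    assume "\<not> y \<le> L"
    with that obtain z where "z \<in> op_spectrum T" "L < cmod z" by auto
    then show False
      using not_in_spectrum[OF assms(1-4)] by blast
  qed
qed


section \<open>Growth of iterated words\<close>

lemma subst_word_sum_list:
  fixes f :: "'a \<Rightarrow> real"
  shows "(\<Sum>b\<leftarrow>subst_word \<rho> u. f b) = (\<Sum>b\<leftarrow>u. \<Sum>d\<leftarrow>\<rho> b. f d)"
  by (induction u) (auto simp: subst_word_def)

lemma subst_op_funpow_apply:
  fixes \<rho> :: "'a::topological_space \<Rightarrow> 'a list"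
  assumes "compact (UNIV :: 'a set)" "continuous_map euclidean word_topology \<rho>"
  shows "apply_bcontfun ((blinfun_apply (subst_op \<rho>) ^^ n) f) a =
    (\<Sum>b\<leftarrow>subst_iter \<rho> n a. apply_bcontfun f b)"
proof (induction n arbitrary: f)
  case (Suc n)
  have "apply_bcontfun ((blinfun_apply (subst_op \<rho>) ^^ Suc n) f) a =
      (\<Sum>b\<leftarrow>subst_iter \<rho> n a. apply_bcontfun (blinfun_apply (subst_op \<rho>) f) b)"
    \<comment> \<open>One application of the operator is moved onto \<open>f\<close>, which is why
      the induction generalises over \<open>f\<close>.\<close>
    unfolding funpow_Suc_right by (simp add: Suc)
  also have "\<dots> = (\<Sum>b\<leftarrow>subst_iter \<rho> (Suc n) a. apply_bcontfun f b)"
    by (simp add: subst_iter_def subst_word_sum_list subst_op_apply[OF assms])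
  finally show ?case .
qed (simp add: subst_iter_def)

lemma sum_list_bounds:
  fixes f :: "'a \<Rightarrow> real"
  assumes "\<And>b. m \<le> f b" "\<And>b. f b \<le> M"
  shows "m * real (length u) \<le> (\<Sum>b\<leftarrow>u. f b)" "(\<Sum>b\<leftarrow>u. f b) \<le> M * real (length u)"
proof (induction u)
  case (Cons b u)
  case 1 show ?case using Cons assms(1)[of b] by (simp add: algebra_simps)
  case 2 show ?case using Cons assms(2)[of b] by (simp add: algebra_simps)
qed simp_all

text \<open>The zero set of \<open>l\<close> is closed and mapped by \<open>\<rho>\<close> to words
  over itself: a vanishing sum of non-negative terms vanishes termwise. It is proper because
  \<open>l\<close> is non-zero, so irreducibility makes it empty.\<close>

lemma natural_length_pos:
  fixes \<rho> :: "'a::topological_space \<Rightarrow> 'a list"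
  assumes comp: "compact (UNIV :: 'a set)" "continuous_map euclidean word_topology \<rho>"
    and irr: "irreducible_subst \<rho>" and l: "natural_length \<rho> l"
  shows "0 < apply_bcontfun l a"
proof -
  obtain c where c: "blinfun_apply (subst_op \<rho>) l = c *\<^sub>R l"
    using l by (auto simp: natural_length_def)
  have nonneg: "0 \<le> apply_bcontfun l b" for b
    using l by (simp add: natural_length_def)
  define Z where "Z = {b. apply_bcontfun l b = 0}"
  have "closed Z"
    unfolding Z_def by (intro closed_Collect_eq) auto
  moreover have "Z \<noteq> UNIV"
    using l by (auto simp: natural_length_def Z_def intro!: bcontfun_eqI)
  moreover have "\<rho> ` Z \<subseteq> lists Z"
  proof (clarsimp simp: Z_def)
    fix b d assume b: "apply_bcontfun l b = 0" "d \<in> set (\<rho> b)"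
    have "(\<Sum>e\<leftarrow>\<rho> b. apply_bcontfun l e) = 0"
      using subst_op_apply[OF comp, of l b] b by (simp add: c)
    then have "\<forall>x\<in>set (map (apply_bcontfun l) (\<rho> b)). x = 0"
      by (subst (asm) sum_list_nonneg_eq_0_iff) (auto simp: nonneg)
    with b(2) show "apply_bcontfun l d = 0"
      by simp
  qed
  ultimately have "Z = {}"
    using irr unfolding irreducible_subst_def by blast
  then show ?thesis
    using nonneg[of a] by (auto simp: Z_def less_le)
qed

theorem proposition3p5:
  fixes \<rho> :: "'a::t2_space \<Rightarrow> 'a list" and l :: "'a \<Rightarrow>\<^sub>C real" and r :: real
  assumes "compact (UNIV :: 'a set)"
    and "substitution \<rho>"
    and "irreducible_subst \<rho>"
    and "natural_length \<rho> l"
    and "uniquely_ergodic (subshift \<rho>)"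
    and "r = op_spectral_radius (subst_op \<rho>)"
  shows "\<exists>c>0. \<forall>\<epsilon>>0. \<exists>N. \<forall>n\<ge>N. \<forall>a.
    \<bar>r ^ n * apply_bcontfun (c *\<^sub>R l) a / real (length (subst_iter \<rho> n a)) - 1\<bar> \<le> \<epsilon>"
proof -
  note comp = assms(1)
  have cont: "continuous_map euclidean word_topology \<rho>"
    and grow: "\<And>k. \<exists>n a. length (subst_iter \<rho> n a) \<ge> k"
    using assms(2) by (auto simp: substitution_def)
  note pos = natural_length_pos[OF comp cont assms(3,4)]
  note funpow = subst_op_funpow_apply[OF comp cont]
  let ?l = "apply_bcontfun l" and ?T = "blinfun_apply (subst_op \<rho>)"
  let ?len = "\<lambda>n a. real (length (subst_iter \<rho> n a))"
  obtain L where L: "0 \<le> L" "?T l = L *\<^sub>R l"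
    using assms(4) by (auto simp: natural_length_def)
  have "l \<noteq> 0"
    using assms(4) by (simp add: natural_length_def)
  \<comment> \<open>Compactness turns pointwise positivity into the uniform lower bound
    \<open>?l a0\<close>.\<close>
  obtain a0 where a0: "\<And>a. ?l a0 \<le> ?l a"
    using continuous_attains_inf[OF comp, of ?l] by auto
  define M where "M = norm l"
  have M: "?l a \<le> M" for a
    using norm_bounded[of l a] by (simp add: M_def)
  have "0 < ?l a0" "0 < M"
    using pos[of a0] M[of a0] by auto
  have "(?T ^^ n) l = L ^ n *\<^sub>R l" for n
    by (induction n) (simp_all add: L blinfun.bilinear_simps mult.commute)
  then have sum_l: "(\<Sum>b\<leftarrow>subst_iter \<rho> n a. ?l b) = L ^ n * ?l a" for n a
    using funpow[of n l a] by simp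
  have len_upper: "?l a0 * ?len n a \<le> L ^ n * M" and len_lower: "L ^ n * ?l a0 \<le> M * ?len n a" for n a
  proof -
    note b = sum_list_bounds[of "?l a0" ?l M "subst_iter \<rho> n a", OF a0 M, unfolded sum_l]
    have "L ^ n * ?l a \<le> L ^ n * M" "L ^ n * ?l a0 \<le> L ^ n * ?l a"
      using L(1) M a0 by (auto intro: mult_left_mono)
    with b show "?l a0 * ?len n a \<le> L ^ n * M" "L ^ n * ?l a0 \<le> M * ?len n a"
      by linarith+
  qed
  have "r = L"
    unfolding assms(6)
  \<comment> \<open>The \<open>n\<close>-th power of the operator multiplies norms by at most the
    largest length of an \<open>n\<close>-th iterate, which \<open>len_upper\<close> bounds by
    \<open>L ^ n * M / ?l a0\<close>.\<close>
  proof (rule spectral_radius_eigenvalue[where C = "M / ?l a0" and x = l])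
    fix n and f :: "'a \<Rightarrow>\<^sub>C real"
    show "norm ((?T ^^ n) f) \<le> M / ?l a0 * L ^ n * norm f"
    proof (rule norm_bound)
      fix a
      have f: "- norm f \<le> apply_bcontfun f b" "apply_bcontfun f b \<le> norm f" for b
        using norm_bounded[of f b] by auto
      have "\<bar>apply_bcontfun ((?T ^^ n) f) a\<bar> \<le> norm f * ?len n a"
        using sum_list_bounds[of "- norm f" "apply_bcontfun f" "norm f" "subst_iter \<rho> n a", OF f]
        by (simp add: funpow abs_le_iff)
      also have "\<dots> \<le> norm f * (L ^ n * M / ?l a0)"
        using len_upper[of n a] \<open>0 < ?l a0\<close> by (intro mult_left_mono) (auto simp: field_simps)
      finally show "norm (apply_bcontfun ((?T ^^ n) f) a) \<le> M / ?l a0 * L ^ n * norm f"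
        by (simp add: mult_ac)
    qed
  qed (use L bcontfun_Cauchy_convergent \<open>l \<noteq> 0\<close> \<open>0 < ?l a0\<close> \<open>0 < M\<close> in auto)
  have "1 < L"
  proof (rule ccontr)
    assume "\<not> 1 < L"
    \<comment> \<open>If \<open>L\<close> were at most 1, \<open>M / ?l a0\<close> would bound all
      lengths, against the assumption of arbitrarily long words.\<close>
    obtain k :: nat where k: "M / ?l a0 < real k"
      using reals_Archimedean2 by blast
    obtain n a where "k \<le> length (subst_iter \<rho> n a)"
      using grow by blast
    then have "?l a0 * real k \<le> ?l a0 * ?len n a"
      using \<open>0 < ?l a0\<close> by simp
    also have "\<dots> \<le> L ^ n * M"
      by (rule len_upper)
    also have "\<dots> \<le> 1 * M"
      using \<open>\<not> 1 < L\<close> L(1) \<open>0 < M\<close> by (intro mult_right_mono) (auto intro: power_le_one)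
    finally show False
      using k \<open>0 < ?l a0\<close> by (simp add: field_simps)
  qed
  have long: "\<exists>N. \<forall>n\<ge>N. \<forall>a. K \<le> length (subst_iter \<rho> n a)" for K
  proof -
    obtain N where N: "M * real K / ?l a0 < L ^ N"
      using real_arch_pow[OF \<open>1 < L\<close>] by blast
    have "K \<le> length (subst_iter \<rho> n a)" if "n \<ge> N" for n a
    proof -
      have "M * real K < L ^ N * ?l a0"
        using N \<open>0 < ?l a0\<close> by (simp add: field_simps)
      also have "\<dots> \<le> L ^ n * ?l a0"
        using that \<open>1 < L\<close> \<open>0 < ?l a0\<close> by (intro mult_right_mono power_increasing) auto
      also have "\<dots> \<le> M * ?len n a"
        by (rule len_lower)
      finally show ?thesis
        using \<open>0 < M\<close> by simp
    qed
    then show ?thesis by blast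
  qed
  obtain m where m: "\<And>\<epsilon>. \<epsilon> > 0 \<Longrightarrow> \<exists>K. \<forall>u n a. sublist u (subst_iter \<rho> n a) \<longrightarrow> K \<le> length u \<longrightarrow>
      \<bar>(\<Sum>b\<leftarrow>u. ?l b) / real (length u) - m\<bar> \<le> \<epsilon>"
    using uniform_letter_averages[OF comp continuous_on_apply_bcontfun assms(5), of l] by metis
  have ratio: "\<exists>N. \<forall>n\<ge>N. \<forall>a. 0 < ?len n a \<and> \<bar>L ^ n * ?l a / ?len n a - m\<bar> \<le> \<epsilon>" if "\<epsilon> > 0" for \<epsilon>
  proof -
    \<comment> \<open>The averages are applied to the whole iterated word, as a factor of
      itself.\<close>
    obtain K where K: "\<And>n a. K \<le> length (subst_iter \<rho> n a) \<Longrightarrow> \<bar>L ^ n * ?l a / ?len n a - m\<bar> \<le> \<epsilon>"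
      using m[OF \<open>\<epsilon> > 0\<close>] sum_l by (metis sublist_order.order.refl)
    \<comment> \<open>The 1 in the maximum rules out empty words, so the quotients are
      genuine.\<close>
    obtain N where "\<forall>n\<ge>N. \<forall>a. max 1 K \<le> length (subst_iter \<rho> n a)"
      using long by blast
    then show ?thesis
      using K by (intro exI[of _ N]) (auto simp: Suc_le_eq)
  qed
  have "0 < m"
  proof -
    \<comment> \<open>All averages of \<open>l\<close> are at least \<open>?l a0\<close>, so a
      tolerance of half of it keeps \<open>m\<close> positive.\<close>
    obtain N where N: "\<And>n a. n \<ge> N \<Longrightarrow> 0 < ?len n a \<and> \<bar>L ^ n * ?l a / ?len n a - m\<bar> \<le> ?l a0 / 2"
      using ratio[of "?l a0 / 2"] \<open>0 < ?l a0\<close> by auto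
    have "?l a0 * ?len N a0 \<le> L ^ N * ?l a0"
      using sum_list_bounds(1)[of "?l a0" ?l M "subst_iter \<rho> N a0", OF a0 M] by (simp add: sum_l)
    then have "?l a0 \<le> L ^ N * ?l a0 / ?len N a0"
      using N[of N a0] by (simp add: field_simps)
    moreover have "0 < m" if "\<bar>y - m\<bar> \<le> e / 2" "e \<le> y" "0 < e" for y e
      using that by linarith
    ultimately show ?thesis
      using N[OF order.refl, of a0] \<open>0 < ?l a0\<close> by blast
  qed
  have "\<exists>N. \<forall>n\<ge>N. \<forall>a. \<bar>r ^ n * apply_bcontfun ((1 / m) *\<^sub>R l) a / ?len n a - 1\<bar> \<le> \<epsilon>" if "\<epsilon> > 0" for \<epsilon>
  proof -
    \<comment> \<open>The factor \<open>m\<close> in the tolerance compensates for the rescaling of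
      \<open>l\<close> by \<open>1 / m\<close>.\<close>
    obtain N where N: "\<And>n a. n \<ge> N \<Longrightarrow> \<bar>L ^ n * ?l a / ?len n a - m\<bar> \<le> \<epsilon> * m"
      using ratio[of "\<epsilon> * m"] \<open>\<epsilon> > 0\<close> \<open>0 < m\<close> by auto
    have "\<bar>r ^ n * apply_bcontfun ((1 / m) *\<^sub>R l) a / ?len n a - 1\<bar> \<le> \<epsilon>" if "n \<ge> N" for n a
    proof -
      have "r ^ n * apply_bcontfun ((1 / m) *\<^sub>R l) a / ?len n a - 1 = (L ^ n * ?l a / ?len n a - m) / m"
        using \<open>0 < m\<close> by (simp add: \<open>r = L\<close> diff_divide_distrib)
      then show ?thesis
        using N[OF that, of a] \<open>0 < m\<close> by (simp add: abs_divide divide_le_eq)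
    qed
    then show ?thesis by blast
  qed
  then show ?thesis
    using \<open>0 < m\<close> by (intro exI[of _ "1 / m"]) auto
qed

end
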